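(* Let $\mathcal{X}$ and $\mathcal{A}$ be finite sets, $K$ a positive integer, $x_1\in\mathcal{X}$ given, $\{\xi_k\}_{k=1}^{K-1}$ an i.i.d. random sequence, $h$ a state-transition function with $h(x,a,\xi)\in\mathcal{X}$, and $\tilde g:\mathcal{X}^*\times\mathcal{A}^*\to\mathbb{R}_+$ a function, where $\mathcal{X}^*=\mathcal{X}\cup\mathcal{X}^2\cup\cdots$ and $\mathcal{A}^*=\mathcal{A}\cup\mathcal{A}^2\cup\cdots$. Let $\tilde\Pi_K^*=(\tilde\pi_1^*,\dots,\tilde\pi_K^* )$ be an optimal solution of the stochastic control problem of maximizing $\mathrm{E}[\tilde g(x_1,\dots,x_K;\pi_1(x_1),\dots,\pi_K(x_K))\mid x_1]$ over policies $(\pi_1,\dots,\pi_K)$ subject to $x_{k+1}=h(x_k,\pi_k(x_k),\xi_k)$, $k=1,\dots,K-1$. Define, on finite strings of policies, $$\tilde g_{\mathrm{avg}}(\pi_1,\dots,\pi_k)=\mathrm{E}[\tilde g(x_1,\dots,x_k;\pi_1(x_1),\dots,\pi_k(x_k))\mid x_1],\qquad x_{i+1}=h(x_i,\pi_i(x_i),\xi_i),$$ with $\tilde g_{\mathrm{avg}}(\emptyset)=0$. If $\tilde g_{\mathrm{avg}}$ is prefix-monotone, then any path-dependent action optimization (PDAO) scheme $\Pi_K^p=(\pi_1^p,\dots,\pi_K^p)$ for this problem satisfies $$\frac{\tilde g_{\mathrm{avg}}(\Pi_K^p)}{\tilde g_{\mathrm{avg}}(\tilde\Pi_K^* )}\ \ge\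 \frac1\eta\left(1-\left(1-\eta\,\frac{1-\sigma}{K}\right)^K\right)\ >\ \frac{1-e^{-\eta(1-\sigma)}}{\eta},$$ where $\eta$ and $\sigma$ are the total curvature and the forward curvature of $\tilde g_{\mathrm{avg}}$ from the greedy trajectory $\Pi_K^p$.
   Context: Policy: a policy $\pi_k$ at time $k$ is a (randomized) mapping assigning to each state in $\mathcal{X}$ an action in $\mathcal{A}$, where the chosen action is a random variable measurable with respect to $\xi_1,\dots,\xi_{k-1}$. A string $(\pi_1,\dots,\pi_K)$ is also called a policy. $\mathrm{E}[\cdot\mid x_1]$ is expectation given the initial state. $\mathcal{P}^*$ is the set of all finite strings of policies $(\pi_1,\dots,\pi_k)$, $k=0,1,2,\dots$ ($k=0$ being the empty string $\emptyset$), the entry in position $j$ being used at time $j$; concatenated strings such as $(G_{1:i},m_j)$ below are included and evaluated by the same formula for $\tilde g_{\mathrm{avg}}$ (with $m_j$ used at time $i+1$). PDAO scheme: given $x_1^p=x_1$, the policy $(\pi_1^p,\dots,\pi_K^p)$ is a PDAO scheme if for every $k=1,\dots,K$ (along every sample path $\xi_1,\dots,\xi_{k-1}$) $$\pi_k^p(x_k^p)\in\operatorname*{argmax}_{a\in\mathcal{A}}\ \tilde g(x_1^p,\dots,x_k^p;\pi_1^p(x_1^p),\dots,\pi_{k-1}^p(x_{k-1}^p),a),$$ where $x_{i+1}^p=h(x_i^p,\pi_i^p(x_i^p),\xi_i)$ for $1\le i\le k-1$. Prefix-monotone: for strings $M,N\in\mathcal{P}^*$ write $M\preceq N$ if $N=(M,L)$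 (concatenation) for some string $L\in\mathcal{P}^*$; a function $f$ on $\mathcal{P}^*$ is prefix-monotone if $f(N)\ge f(M)$ whenever $M\preceq N$ and $|N|\le K$, where $|N|$ is the length of $N$. Curvatures: let $f=\tilde g_{\mathrm{avg}}$ and $G=\Pi_K^p$. For a string $M=(m_1,\dots,m_K)$ put $M_{i:j}=(m_i,\dots,m_j)$, with $M_{i+1:i}=\emptyset$ and $G_{1:0}=\emptyset$. The total curvature is $$\eta=\max_{\substack{M\in\mathcal{P}^*,\ |M|=K\\ 1\le i\le K-1}}\ \frac{K}{K-i}\left\{1-\frac{f((G_{1:i},M_{i+1:K}))-\frac{K-i}{K}f(M)}{f(G_{1:i})}\right\},$$ and the forward curvature is $$\sigma=\max_{\substack{0\le i\le K-1,\ i+1\le j\le K\\ M_{i+1:j}}}\left\{1-\frac{f((G_{1:i},m_j))-f(G_{1:i})}{f((G_{1:i},M_{i+1:j}))-f((G_{1:i},M_{i+1:j-1}))}\right\}.$$ Well-definedness conventions: the maxima are taken over those choices for which the denominators are nonzero and are assumed to exist; $\tilde g_{\mathrm{avg}}(\tilde\Pi_K^* )>0$ and $\eta\ne0$, so that the displayed expressions make sense.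
   Formalization: The strict second inequality is claimed only when η > 0 and σ < 1; as printed it is false otherwise (if σ = 1 both sides are 0; if η < 0 and σ < 1 it reverses, e.g. one state and action, K = 2, rewards 1 then 3). The first inequality is proved for all η ≠ 0. *)

theory Defs
  imports "HOL-Probability.Probability"
begin

text \<open>
  Strings are lists; the entry for time \<open>k\<close> is the list element with index \<open>k - 1\<close>. States and
  actions range over finite types, the noise over an arbitrary measurable space \<open>N\<close>.
\<close>

section \<open>String optimization\<close>

text \<open>\<open>substr M i j\<close> is $M_{i:j} = (m_i,\dots,m_j)$ for \<open>1 \<le> i\<close>; it is empty for \<open>j < i\<close>.\<close>

definition substr :: "'s list \<Rightarrow> nat \<Rightarrow> nat \<Rightarrow> 's list" where
  "substr M i j = drop (i - 1) (take j M)"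

definition prefix_monotone :: "'s list set \<Rightarrow> nat \<Rightarrow> ('s list \<Rightarrow> real) \<Rightarrow> bool" where
  "prefix_monotone P K f \<longleftrightarrow>
     (\<forall>M\<in>P. \<forall>N\<in>P. (\<exists>L. N = M @ L) \<longrightarrow> length N \<le> K \<longrightarrow> f M \<le> f N)"

definition total_curvature_values ::
  "'s list set \<Rightarrow> nat \<Rightarrow> ('s list \<Rightarrow> real) \<Rightarrow> 's list \<Rightarrow> real set" where
  "total_curvature_values P K f G =
     {real K / real (K - i) *
        (1 - (f (substr G 1 i @ substr M (i + 1) K) - real (K - i) / real K * f M)
               / f (substr G 1 i)) | M i.
      M \<in> P \<and> length M = K \<and> 1 \<le> i \<and> i \<le> K - 1 \<and> f (substr G 1 i) \<noteq> 0}"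

text \<open>
  In the numerator the policy $m_j$ is moved to time $i+1 \le j$, where it may anticipate noise that
  is not yet available; that string need not lie in \<open>P\<close>, but \<open>f\<close> is evaluated on it all the same.
\<close>

definition forward_curvature_values ::
  "'s list set \<Rightarrow> nat \<Rightarrow> ('s list \<Rightarrow> real) \<Rightarrow> 's list \<Rightarrow> real set" where
  "forward_curvature_values P K f G =
     {1 - (f (substr G 1 i @ [M ! (j - 1)]) - f (substr G 1 i))
            / (f (substr G 1 i @ substr M (i + 1) j)
               - f (substr G 1 i @ substr M (i + 1) (j - 1))) | M i j.
      M \<in> P \<and> length M = K \<and> i \<le> K - 1 \<and> i + 1 \<le> j \<and> j \<le> K \<and>
      f (substr G 1 i @ substr M (i + 1) j)
        - f (substr G 1 i @ substr M (i + 1) (j - 1)) \<noteq> 0}"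

definition has_maximum :: "real set \<Rightarrow> bool" where
  "has_maximum S \<longleftrightarrow> (\<exists>c\<in>S. \<forall>d\<in>S. d \<le> c)"

text \<open>The two curvatures are meaningful only if the respective value set satisfies
  \<open>has_maximum\<close>.\<close>

definition total_curvature ::
  "'s list set \<Rightarrow> nat \<Rightarrow> ('s list \<Rightarrow> real) \<Rightarrow> 's list \<Rightarrow> real" where
  "total_curvature P K f G = (GREATEST c. c \<in> total_curvature_values P K f G)"

definition forward_curvature ::
  "'s list set \<Rightarrow> nat \<Rightarrow> ('s list \<Rightarrow> real) \<Rightarrow> 's list \<Rightarrow> real" where
  "forward_curvature P K f G = (GREATEST c. c \<in> forward_curvature_values P K f G)"


section \<open>Stochastic control\<close>

text \<open>A policy maps a state and a sample point to an action.\<close>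

type_synonym ('x, 'w, 'a) policy = "'x \<Rightarrow> 'w \<Rightarrow> 'a"

text \<open>The \<open>\<sigma>\<close>-algebra generated by $\xi_1,\dots,\xi_{k-1}$ (trivial for \<open>k = 1\<close>).\<close>

definition history :: "'w measure \<Rightarrow> 'e measure \<Rightarrow> (nat \<Rightarrow> 'w \<Rightarrow> 'e) \<Rightarrow> nat \<Rightarrow> 'w measure" where
  "history M N \<xi> k =
     vimage_algebra (space M) (\<lambda>\<omega>. \<lambda>i\<in>{1..<k}. \<xi> i \<omega>) (\<Pi>\<^sub>M i\<in>{1..<k}. N)"

definition policy_at ::
  "'w measure \<Rightarrow> 'e measure \<Rightarrow> (nat \<Rightarrow> 'w \<Rightarrow> 'e) \<Rightarrow> nat \<Rightarrow> ('x, 'w, 'a) policy set" where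
  "policy_at M N \<xi> k = {p. \<forall>x. p x \<in> history M N \<xi> k \<rightarrow>\<^sub>M count_space UNIV}"

definition policy_strings ::
  "'w measure \<Rightarrow> 'e measure \<Rightarrow> (nat \<Rightarrow> 'w \<Rightarrow> 'e) \<Rightarrow> ('x, 'w, 'a) policy list set" where
  "policy_strings M N \<xi> = {ps. \<forall>k\<in>{1..length ps}. ps ! (k - 1) \<in> policy_at M N \<xi> k}"

text \<open>\<open>state_at \<xi> h x\<^sub>1 ps \<omega> n\<close> is $x_{n+1}$ and \<open>action_at \<xi> h x\<^sub>1 ps \<omega> n\<close> is
  $\pi_{n+1}(x_{n+1})$, on the sample path \<open>\<omega>\<close>.\<close>

primrec state_at ::
  "(nat \<Rightarrow> 'w \<Rightarrow> 'e) \<Rightarrow> ('x \<Rightarrow> 'a \<Rightarrow> 'e \<Rightarrow> 'x) \<Rightarrow> 'x \<Rightarrow> ('x, 'w, 'a) policy list \<Rightarrow> 'w \<Rightarrow> nat \<Rightarrow> 'x"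
where
  "state_at \<xi> h x\<^sub>1 ps \<omega> 0 = x\<^sub>1"
| "state_at \<xi> h x\<^sub>1 ps \<omega> (Suc n) =
     h (state_at \<xi> h x\<^sub>1 ps \<omega> n) ((ps ! n) (state_at \<xi> h x\<^sub>1 ps \<omega> n) \<omega>) (\<xi> (Suc n) \<omega>)"

definition action_at ::
  "(nat \<Rightarrow> 'w \<Rightarrow> 'e) \<Rightarrow> ('x \<Rightarrow> 'a \<Rightarrow> 'e \<Rightarrow> 'x) \<Rightarrow> 'x \<Rightarrow> ('x, 'w, 'a) policy list \<Rightarrow> 'w \<Rightarrow> nat \<Rightarrow> 'a"
where
  "action_at \<xi> h x\<^sub>1 ps \<omega> n = (ps ! n) (state_at \<xi> h x\<^sub>1 ps \<omega> n) \<omega>"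

definition g_avg ::
  "'w measure \<Rightarrow> (nat \<Rightarrow> 'w \<Rightarrow> 'e) \<Rightarrow> ('x \<Rightarrow> 'a \<Rightarrow> 'e \<Rightarrow> 'x) \<Rightarrow> 'x \<Rightarrow>
   ('x list \<Rightarrow> 'a list \<Rightarrow> real) \<Rightarrow> ('x, 'w, 'a) policy list \<Rightarrow> real" where
  "g_avg M \<xi> h x\<^sub>1 g ps =
     (if ps = [] then 0
      else (LINT \<omega>|M. g (map (state_at \<xi> h x\<^sub>1 ps \<omega>) [0..<length ps])
                       (map (action_at \<xi> h x\<^sub>1 ps \<omega>) [0..<length ps])))"

definition optimal_policy ::
  "'w measure \<Rightarrow> 'e measure \<Rightarrow> (nat \<Rightarrow> 'w \<Rightarrow> 'e) \<Rightarrow> ('x \<Rightarrow> 'a \<Rightarrow> 'e \<Rightarrow> 'x) \<Rightarrow> 'x \<Rightarrow>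
   ('x list \<Rightarrow> 'a list \<Rightarrow> real) \<Rightarrow> nat \<Rightarrow> ('x, 'w, 'a) policy list \<Rightarrow> bool" where
  "optimal_policy M N \<xi> h x\<^sub>1 g K ps \<longleftrightarrow>
     is_arg_max (g_avg M \<xi> h x\<^sub>1 g) (\<lambda>qs. qs \<in> policy_strings M N \<xi> \<and> length qs = K) ps"

definition pdao_scheme ::
  "'w measure \<Rightarrow> 'e measure \<Rightarrow> (nat \<Rightarrow> 'w \<Rightarrow> 'e) \<Rightarrow> ('x \<Rightarrow> 'a \<Rightarrow> 'e \<Rightarrow> 'x) \<Rightarrow> 'x \<Rightarrow>
   ('x list \<Rightarrow> 'a list \<Rightarrow> real) \<Rightarrow> nat \<Rightarrow> ('x, 'w, 'a) policy list \<Rightarrow> bool" where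
  "pdao_scheme M N \<xi> h x\<^sub>1 g K ps \<longleftrightarrow>
     ps \<in> policy_strings M N \<xi> \<and> length ps = K \<and>
     (\<forall>\<omega>\<in>space M. \<forall>n<K.
        is_arg_max
          (\<lambda>a. g (map (state_at \<xi> h x\<^sub>1 ps \<omega>) [0..<Suc n])
                 (map (action_at \<xi> h x\<^sub>1 ps \<omega>) [0..<n] @ [a]))
          (\<lambda>a. a \<in> UNIV)
          (action_at \<xi> h x\<^sub>1 ps \<omega> n))"

end

theory Submission
  imports Defs
begin

text \<open>
  Write $a_i = f(G_{1:i})$ and $F = f(\tilde\Pi_K^*)$. Telescoping the definition of $\sigma$ along
  the optimal string and using greediness gives
  $(1-\sigma)(f(G_{1:i},\tilde\Pi^*_{i+1:K}) - a_i) \le (K-i)(a_{i+1}-a_i)$; the definition of $\eta$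
  bounds the left-hand side below, so with $t = (1-\sigma)/K$ we get
  $a_{i+1} \ge (1-\eta t)\,a_i + tF$. Solving this recurrence requires $\sigma \le 1$ and
  $\eta t \le 1$. The first holds because an anticipating policy at the last
  position does no worse than the adapted policy that minimizes the reward on every sample path; the
  second because $\eta \le F/a_i$ for some $i \ge 1$, while $tF \le a_1 \le a_i$. If $a_1 = 0$, where
  the quotients in $\eta$ degenerate, then $\sigma = 1$ and the bound is $0$.
\<close>

section \<open>Curvature bounds for greedy strings\<close>

text \<open>Both halves are needed: maximality gives the lower bounds for the spliced strings, while
  membership lets \<sigma> and \<eta> themselves be estimated from above.\<close>

lemma Greatest_has_maximum:
  assumes "has_maximum S"
  shows "(GREATEST c. c \<in> S) \<in> S" and "\<And>d. d \<in> S \<Longrightarrow> d \<le> (GREATEST c. c \<in> S)"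
proof -
  obtain c where c: "c \<in> S" "\<forall>d\<in>S. d \<le> c"
    using assms unfolding has_maximum_def by blast
  then have "(GREATEST c. c \<in> S) = c"
    by (intro Greatest_equality) auto
  with c show "(GREATEST c. c \<in> S) \<in> S" and "\<And>d. d \<in> S \<Longrightarrow> d \<le> (GREATEST c. c \<in> S)"
    by auto
qed

text \<open>The right-hand side solves the recurrence with equality. Since
  \<open>\<eta> * t \<le> 1\<close>, the factor \<open>1 - \<eta> * t\<close> is nonnegative and
  multiplying by it preserves the inequality; \<eta> itself may be negative.\<close>

lemma linear_recurrence_lower_bound:
  fixes a :: "nat \<Rightarrow> real"
  assumes "\<eta> \<noteq> 0" and "\<eta> * t \<le> 1" and "a 0 = 0"
    and step: "\<And>i. i < n \<Longrightarrow> a (Suc i) \<ge> (1 - \<eta> * t) * a i + t * F"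
  shows "a n \<ge> F / \<eta> * (1 - (1 - \<eta> * t) ^ n)"
  using step
proof (induction n)
  case 0
  then show ?case using \<open>a 0 = 0\<close> by simp
next
  case (Suc n)
  have "F / \<eta> * (1 - (1 - \<eta> * t) ^ Suc n)
      = (1 - \<eta> * t) * (F / \<eta> * (1 - (1 - \<eta> * t) ^ n)) + t * F"
    using \<open>\<eta> \<noteq> 0\<close> by (simp add: field_simps)
  also have "\<dots> \<le> (1 - \<eta> * t) * a n + t * F"
    using Suc \<open>\<eta> * t \<le> 1\<close> by (intro add_right_mono mult_left_mono) auto
  also have "\<dots> \<le> a (Suc n)"
    using Suc.prems by simp
  finally show ?case .
qed

text \<open>A strict form of \<open>1 - x < exp (- x)\<close> is raised to the power
  \<open>n\<close>; \<open>u \<le> real n\<close> keeps the base nonnegative.\<close>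

lemma one_minus_power_less_exp:
  fixes u :: real
  assumes "0 < u" "u \<le> real n"
  shows "(1 - u / real n) ^ n < exp (- u)"
proof -
  have n: "n > 0" using assms by (cases n) auto
  define x where "x = u / real n"
  \<comment> \<open>The weak bound \<open>1 + y \<le> exp y\<close> is used at
    \<open>y = - x / 2\<close> and squared; the surplus x^2/4 supplies strictness.\<close>
  have "1 - x < (1 - x / 2)\<^sup>2"
    using assms n by (simp add: x_def power2_eq_square field_simps)
  also have "\<dots> \<le> exp (- x / 2) ^ 2"
    using assms n exp_ge_add_one_self[of "- x / 2"]
    by (intro power_mono) (auto simp: x_def field_simps)
  also have "\<dots> = exp (- x)"
    by (simp flip: exp_of_nat_mult)
  finally have "1 - u / real n < exp (- u / real n)"
    by (simp add: x_def)
  then have "(1 - u / real n) ^ n < exp (- u / real n) ^ n"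
    using assms n by (intro power_strict_mono) (auto simp: field_simps)
  also have "\<dots> = exp (- u)"
    using n by (simp flip: exp_of_nat_mult)
  finally show ?thesis .
qed

text \<open>This isolates what the recurrence argument uses. \<open>splice\<close> keeps each entry
  at its own time. In \<open>take i G @ [M ! j]\<close> the entry may change its time and the string
  may leave \<open>P\<close>, so \<open>greedy\<close> and \<open>gain_nonneg\<close> are separate
  assumptions rather than consequences of \<open>monotone\<close>.\<close>

locale greedy_string =
  fixes P :: "'s list set" and K :: nat and f :: "'s list \<Rightarrow> real" and G Opt :: "'s list"
  assumes K_pos: "K \<ge> 1"
    and f_Nil: "f [] = 0"
    and splice: "\<And>A B i j. A \<in> P \<Longrightarrow> B \<in> P \<Longrightarrow> length A = K \<Longrightarrow> length B = K \<Longrightarrow> i \<le> j \<Longrightarrow> j \<le> K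
                   \<Longrightarrow> take i A @ drop i (take j B) \<in> P"
    and monotone: "prefix_monotone P K f"
    and G: "G \<in> P" "length G = K"
    and Opt: "Opt \<in> P" "length Opt = K"
    and optimal: "\<And>M. M \<in> P \<Longrightarrow> length M = K \<Longrightarrow> f M \<le> f Opt"
    and f_Opt_pos: "f Opt > 0"
    and greedy: "\<And>M i j. M \<in> P \<Longrightarrow> length M = K \<Longrightarrow> i < K \<Longrightarrow> j < K
                   \<Longrightarrow> f (take i G @ [M ! j]) \<le> f (take (Suc i) G)"
    and gain_nonneg: "\<And>M i j. M \<in> P \<Longrightarrow> length M = K \<Longrightarrow> i < K \<Longrightarrow> j < K
                   \<Longrightarrow> f (take i G) \<le> f (take i G @ [M ! j])"
    and total_max: "has_maximum (total_curvature_values P K f G)"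
    and forward_max: "has_maximum (forward_curvature_values P K f G)"
begin

abbreviation "\<eta> \<equiv> total_curvature P K f G"
abbreviation "\<sigma> \<equiv> forward_curvature P K f G"
abbreviation "a i \<equiv> f (take i G)"

section \<open>Monotonicity along greedy prefixes\<close>

lemma f_mono:
  assumes "A \<in> P" "A @ L \<in> P" "length (A @ L) \<le> K"
  shows "f A \<le> f (A @ L)"
  using monotone assms unfolding prefix_monotone_def by blast

lemma take_G_in_P: "i \<le> K \<Longrightarrow> take i G \<in> P"
  using splice[of G G i i] G by simp

lemma a_mono:
  assumes "i \<le> j" "j \<le> K"
  shows "a i \<le> a j"
proof -
  have "take j G = take i G @ drop i (take j G)"
    using assms by (metis append_take_drop_id min.absorb1 take_take)
  then show ?thesis
    using f_mono[of "take i G" "drop i (take j G)"] take_G_in_P assms G by simp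
qed

lemma a_nonneg: "i \<le> K \<Longrightarrow> a i \<ge> 0"
  using a_mono[of 0 i] f_Nil by simp

text \<open>These differences are the denominators in the forward curvature. Both strings lie in
  \<open>P\<close>, and one extends the other by one entry.\<close>

lemma splice_step_le:
  assumes "M \<in> P" "length M = K" "i < j" "j \<le> K"
  shows "f (take i G @ drop i (take (j - 1) M)) \<le> f (take i G @ drop i (take j M))"
proof -
  have "take j M = take (j - 1) M @ [M ! (j - 1)]"
    using assms by (cases j) (auto simp: take_Suc_conv_app_nth)
  then have eq: "take i G @ drop i (take j M) = (take i G @ drop i (take (j - 1) M)) @ [M ! (j - 1)]"
    using assms by simp
  have "take i G @ drop i (take (j - 1) M) \<in> P" "take i G @ drop i (take j M) \<in> P"
    using assms G by (auto intro!: splice)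
  then show ?thesis
    unfolding eq using assms G by (intro f_mono) auto
qed

text \<open>Maximality of \<sigma>, multiplied out. In this form it also covers a zero denominator,
  where \<open>gain_nonneg\<close> takes over.\<close>

lemma forward_curvature_bound:
  assumes "M \<in> P" "length M = K" "i < j" "j \<le> K"
  shows "(1 - \<sigma>) * (f (take i G @ drop i (take j M)) - f (take i G @ drop i (take (j - 1) M)))
      \<le> f (take i G @ [M ! (j - 1)]) - a i"
    (is "_ * ?d \<le> ?n")
proof (cases "?d = 0")
  case True
  then show ?thesis
    using gain_nonneg[of M i "j - 1"] assms by simp
next
  case False
  then have pos: "?d > 0"
    using splice_step_le[OF assms] by simp
  have "1 - ?n / ?d \<in> forward_curvature_values P K f G"
    unfolding forward_curvature_values_def substr_def mem_Collect_eq
    using assms False by (intro exI[of _ M] exI[of _ i] exI[of _ j]) auto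
  from Greatest_has_maximum(2)[OF forward_max this] have "1 - \<sigma> \<le> ?n / ?d"
    unfolding forward_curvature_def by simp
  then show ?thesis
    using pos by (simp add: field_simps)
qed

text \<open>The maximum is attained, so \<sigma> is one of the values 1 - n/d, with n nonnegative by
  \<open>gain_nonneg\<close> and d by \<open>splice_step_le\<close>.\<close>

lemma forward_curvature_le_1: "\<sigma> \<le> 1"
proof -
  have "\<sigma> \<in> forward_curvature_values P K f G"
    unfolding forward_curvature_def by (rule Greatest_has_maximum[OF forward_max])
  then obtain M i j where *: "M \<in> P" "length M = K" "i \<le> K - 1" "i + 1 \<le> j" "j \<le> K"
    and \<sigma>: "\<sigma> = 1 - (f (take i G @ [M ! (j - 1)]) - a i)
      / (f (take i G @ drop i (take j M)) - f (take i G @ drop i (take (j - 1) M)))"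
    unfolding forward_curvature_values_def substr_def by auto
  show ?thesis
    unfolding \<sigma> using * K_pos splice_step_le[of M i j] gain_nonneg[of M i "j - 1"] by simp
qed

lemma greedy_step:
  assumes "i < K"
  shows "(1 - \<sigma>) * (f (take i G @ drop i Opt) - a i) \<le> real (K - i) * (a (Suc i) - a i)"
proof -
  \<comment> \<open>Telescoping over the first \<open>n\<close> entries of \<open>Opt\<close> after
    time \<open>i\<close>: by \<open>greedy\<close>, each increment is charged to the same greedy
    gain.\<close>
  have "(1 - \<sigma>) * (f (take i G @ drop i (take (i + n) Opt)) - a i) \<le> real n * (a (Suc i) - a i)"
    if "i + n \<le> K" for n
    using that
  proof (induction n)
    case 0
    then show ?case by simp
  next
    case (Suc n)
    have "(1 - \<sigma>) * (f (take i G @ drop i (take (i + Suc n) Opt))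
             - f (take i G @ drop i (take (i + n) Opt))) \<le> a (Suc i) - a i"
      using forward_curvature_bound[of Opt i "i + Suc n"] greedy[of Opt i "i + n"] Opt Suc.prems
      by simp
    then show ?case
      using Suc by (simp add: algebra_simps)
  qed
  from this[of "K - i"] show ?thesis
    using assms Opt by simp
qed

text \<open>Maximality of \<eta>, applied to \<open>Opt\<close> and multiplied out. The index 0 does
  not occur in the definition of \<eta>, but there the bound is an equality because
  \<open>f [] = 0\<close>.\<close>

lemma total_curvature_bound:
  assumes "i < K" "i = 0 \<or> a i \<noteq> 0"
  shows "real (K - i) / real K * (f Opt - \<eta> * a i) \<le> f (take i G @ drop i Opt) - a i"
proof (cases "i = 0")
  case True
  then show ?thesis using assms f_Nil by simp
next
  case False
  define c where "c = real (K - i) / real K"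
  have c: "c > 0" "real K / real (K - i) = 1 / c"
    using assms by (auto simp: c_def)
  have pos: "a i > 0"
    using assms False a_nonneg[of i] by simp
  have "real K / real (K - i) * (1 - (f (take i G @ drop i Opt) - c * f Opt) / a i)
      \<in> total_curvature_values P K f G"
    unfolding total_curvature_values_def substr_def mem_Collect_eq c_def
    using assms False Opt by (intro exI[of _ Opt] exI[of _ i]) auto
  from Greatest_has_maximum(2)[OF total_max this]
  have "1 / c * (1 - (f (take i G @ drop i Opt) - c * f Opt) / a i) \<le> \<eta>"
    unfolding total_curvature_def c by simp
  then have "1 - (f (take i G @ drop i Opt) - c * f Opt) / a i \<le> c * \<eta>"
    using c(1) by (simp add: field_simps)
  then have "a i - (f (take i G @ drop i Opt) - c * f Opt) \<le> c * \<eta> * a i"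
    using pos by (simp add: field_simps)
  then show ?thesis
    unfolding c_def[symmetric] by (simp add: algebra_simps)
qed

text \<open>Here \<eta> is bounded from above, using a pair \<open>M\<close>, \<open>i\<close> that
  attains the maximum: completing the greedy prefix by the tail of \<open>M\<close> does not lower
  \<open>f\<close>, and \<open>f M \<le> f Opt\<close>.\<close>

lemma total_curvature_le:
  obtains i where "1 \<le> i" "i < K" "a i > 0" "\<eta> * a i \<le> f Opt"
proof -
  have "\<eta> \<in> total_curvature_values P K f G"
    unfolding total_curvature_def by (rule Greatest_has_maximum[OF total_max])
  then obtain M i where *: "M \<in> P" "length M = K" "1 \<le> i" "i \<le> K - 1" "a i \<noteq> 0"
    and \<eta>: "\<eta> = real K / real (K - i) *
      (1 - (f (take i G @ drop i M) - real (K - i) / real K * f M) / a i)"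
    unfolding total_curvature_values_def substr_def by auto
  have "a i \<ge> 0"
    using * by (intro a_nonneg) simp
  with \<open>a i \<noteq> 0\<close> have pos: "a i > 0"
    by simp
  have "take i G @ drop i M \<in> P"
    using splice[of G M i K] G * by simp
  then have "a i \<le> f (take i G @ drop i M)"
    using f_mono[of "take i G" "drop i M"] take_G_in_P[of i] G * by simp
  define c where "c = real (K - i) / real K"
  have c: "c > 0" "real K / real (K - i) = 1 / c"
    using * by (auto simp: c_def)
  have "c * (\<eta> * a i) = a i - f (take i G @ drop i M) + c * f M"
    unfolding \<eta> c_def[symmetric] c(2) using c(1) pos by (simp add: field_simps)
  also have "\<dots> \<le> c * f M"
    using \<open>a i \<le> f (take i G @ drop i M)\<close> by simp
  also have "\<dots> \<le> c * f Opt"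
    using optimal[of M] * c by simp
  finally have "\<eta> * a i \<le> f Opt"
    using c(1) by simp
  with that[of i] * pos show thesis by simp
qed

lemma curvature_product_le_1:
  shows "\<eta> * ((1 - \<sigma>) / real K) \<le> 1"
proof -
  define t where "t = (1 - \<sigma>) / real K"
  have t: "t \<ge> 0"
    using forward_curvature_le_1 by (simp add: t_def)
  obtain i where i: "1 \<le> i" "i < K" "a i > 0" "\<eta> * a i \<le> f Opt"
    by (rule total_curvature_le)
  \<comment> \<open>At \<open>i = 0\<close> the spliced string is \<open>Opt\<close> itself, so
    \<open>greedy_step\<close> reads
    \<open>(1 - \<sigma>) * f Opt \<le> real K * a 1\<close>.\<close>
  have "t * f Opt \<le> a 1"
    using greedy_step[of 0] K_pos f_Nil by (simp add: t_def field_simps)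
  then have "t * (\<eta> * a i) \<le> a i"
    using mult_left_mono[OF i(4) t] a_mono[of 1 i] i(1,2) by linarith
  then have "(\<eta> * t) * a i \<le> 1 * a i"
    by (simp add: ac_simps)
  then show ?thesis
    using i(3) unfolding t_def[symmetric] by (rule mult_right_le_imp_le)
qed

text \<open>\<open>greedy_step\<close> at index 0 bounds \<open>(1 - \<sigma>) * f Opt\<close> by a
  multiple of \<open>a 1\<close>, which forces \<sigma> up to 1.\<close>

lemma forward_curvature_eq_1:
  assumes "a 1 = 0"
  shows "\<sigma> = 1"
proof -
  have "(1 - \<sigma>) * f Opt \<le> 0"
    using greedy_step[of 0] K_pos f_Nil assms by simp
  then show ?thesis
    using f_Opt_pos forward_curvature_le_1 by (simp add: mult_le_0_iff)
qed

theorem greedy_bound: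
  assumes "\<eta> \<noteq> 0"
  shows "f G / f Opt \<ge> 1 / \<eta> * (1 - (1 - \<eta> * ((1 - \<sigma>) / real K)) ^ K)"
proof (cases "a 1 = 0")
  case True
  then show ?thesis
    using forward_curvature_eq_1 a_nonneg[of K] f_Opt_pos G by simp
next
  case False
  define t where "t = (1 - \<sigma>) / real K"
  have "a (Suc i) \<ge> (1 - \<eta> * t) * a i + t * f Opt" if i: "i < K" for i
  proof -
    have nz: "i = 0 \<or> a i \<noteq> 0"
      using False a_mono[of 1 i] a_nonneg[of 1] i by (cases "i = 0") auto
    \<comment> \<open>The two curvature bounds meet at the spliced string and share the factor
      \<open>real (K - i)\<close>; cancelling it leaves a recurrence with constant
      coefficients.\<close>
    have "real (K - i) * (t * (f Opt - \<eta> * a i))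
        = (1 - \<sigma>) * (real (K - i) / real K * (f Opt - \<eta> * a i))"
      by (simp add: t_def)
    also have "\<dots> \<le> (1 - \<sigma>) * (f (take i G @ drop i Opt) - a i)"
      using forward_curvature_le_1 by (intro mult_left_mono total_curvature_bound i nz) simp
    also have "\<dots> \<le> real (K - i) * (a (Suc i) - a i)"
      by (rule greedy_step[OF i])
    finally have "t * (f Opt - \<eta> * a i) \<le> a (Suc i) - a i"
      using i by simp
    then show ?thesis by (simp add: algebra_simps)
  qed
  then have "a K \<ge> f Opt / \<eta> * (1 - (1 - \<eta> * t) ^ K)"
    using assms curvature_product_le_1 f_Nil
    by (intro linear_recurrence_lower_bound) (auto simp: t_def)
  then show ?thesis
    using f_Opt_pos G unfolding t_def[symmetric] by (simp add: pos_le_divide_eq ac_simps)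
qed

text \<open>The exponential estimate with \<open>u = \<eta> * (1 - \<sigma>)\<close>. At
  \<open>\<sigma> = 1\<close> both sides would be 0, and division by a negative \<eta> would reverse
  the inequality.\<close>

theorem greedy_bound_greater:
  assumes "\<eta> > 0" "\<sigma> < 1"
  shows "1 / \<eta> * (1 - (1 - \<eta> * ((1 - \<sigma>) / real K)) ^ K) > (1 - exp (- \<eta> * (1 - \<sigma>))) / \<eta>"
proof -
  have "(1 - \<eta> * (1 - \<sigma>) / real K) ^ K < exp (- (\<eta> * (1 - \<sigma>)))"
    using assms curvature_product_le_1 K_pos
    by (intro one_minus_power_less_exp) (auto simp: field_simps)
  then show ?thesis
    using assms(1) by (simp add: divide_strict_right_mono)
qed

end


section \<open>Measurability along sample paths\<close>

text \<open>Lists over a countable type are countable, so the prefix already built can be frozen at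
  a constant value before the next entry is appended.\<close>

lemma measurable_map_upt:
  fixes F :: "'w \<Rightarrow> nat \<Rightarrow> 'b::countable"
  assumes "\<And>i. i < n \<Longrightarrow> (\<lambda>\<omega>. F \<omega> i) \<in> L \<rightarrow>\<^sub>M count_space UNIV"
  shows "(\<lambda>\<omega>. map (F \<omega>) [0..<n]) \<in> L \<rightarrow>\<^sub>M count_space UNIV"
  using assms
proof (induction n)
  case 0
  then show ?case by simp
next
  case (Suc n)
  have IH: "(\<lambda>\<omega>. map (F \<omega>) [0..<n]) \<in> L \<rightarrow>\<^sub>M count_space UNIV"
    using Suc by simp
  have "(\<lambda>\<omega>. xs @ [F \<omega> n]) \<in> L \<rightarrow>\<^sub>M count_space UNIV" for xs
    by (rule measurable_compose[OF Suc.prems[of n]]) auto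
  then have "(\<lambda>\<omega>. map (F \<omega>) [0..<n] @ [F \<omega> n]) \<in> L \<rightarrow>\<^sub>M count_space UNIV"
    by (rule measurable_compose_countable[OF _ IH])
  then show ?case by simp
qed

text \<open>The history is the smallest \<sigma>-algebra for the noise before time \<open>k\<close>;
  hence it is contained in any \<open>L\<close> on the same points that makes this noise
  measurable.\<close>

lemma measurable_ident_history:
  assumes "space L = space M" and "\<And>i. i \<in> {1..<k} \<Longrightarrow> \<xi> i \<in> L \<rightarrow>\<^sub>M N"
  shows "(\<lambda>\<omega>. \<omega>) \<in> L \<rightarrow>\<^sub>M history M N \<xi> k"
  unfolding history_def
  using assms by (intro measurable_vimage_algebra2 measurable_restrict) auto

lemma space_history [simp]: "space (history M N \<xi> k) = space M"
  unfolding history_def by simp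

lemma measurable_noise_history:
  assumes "\<And>i. i \<in> {1..<k} \<Longrightarrow> \<xi> i \<in> M \<rightarrow>\<^sub>M N" and "j \<in> {1..<k}"
  shows "\<xi> j \<in> history M N \<xi> k \<rightarrow>\<^sub>M N"
proof -
  have "(\<lambda>\<omega>. \<lambda>i\<in>{1..<k}. \<xi> i \<omega>) \<in> history M N \<xi> k \<rightarrow>\<^sub>M (\<Pi>\<^sub>M i\<in>{1..<k}. N)"
    unfolding history_def using assms(1)
    by (intro measurable_vimage_algebra1) (auto simp: space_PiM intro: measurable_space)
  from measurable_compose[OF this measurable_component_singleton[OF assms(2)]] show ?thesis
    using assms(2) by simp
qed

lemma policy_measurable:
  assumes "p \<in> policy_at M N \<xi> k" "space L = space M"
    and "\<And>i. i \<in> {1..<k} \<Longrightarrow> \<xi> i \<in> L \<rightarrow>\<^sub>M N"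
  shows "p x \<in> L \<rightarrow>\<^sub>M count_space UNIV"
proof -
  have "p x \<in> history M N \<xi> k \<rightarrow>\<^sub>M count_space UNIV"
    using assms(1) unfolding policy_at_def by blast
  from measurable_compose[OF measurable_ident_history[OF assms(2,3)] this] show ?thesis
    by simp
qed

text \<open>Policies are measurable for each fixed state; as the random state takes countably many
  values, inserting it preserves measurability.\<close>

lemma feedback_measurable:
  fixes S :: "'w \<Rightarrow> 'x::countable"
  assumes "S \<in> L \<rightarrow>\<^sub>M count_space UNIV" "\<And>x. p x \<in> L \<rightarrow>\<^sub>M count_space UNIV"
  shows "(\<lambda>\<omega>. p (S \<omega>) \<omega>) \<in> L \<rightarrow>\<^sub>M count_space UNIV"
  using measurable_compose_countable[OF assms(2,1)] .

lemma state_at_measurable: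
  fixes h :: "'x::countable \<Rightarrow> 'a::countable \<Rightarrow> 'e \<Rightarrow> 'x"
  assumes h: "\<And>x a. h x a \<in> N \<rightarrow>\<^sub>M count_space UNIV"
    and p: "\<And>m x. m < n \<Longrightarrow> (ps ! m) x \<in> L \<rightarrow>\<^sub>M count_space UNIV"
    and \<xi>: "\<And>m. m \<in> {1..n} \<Longrightarrow> \<xi> m \<in> L \<rightarrow>\<^sub>M N"
  shows "(\<lambda>\<omega>. state_at \<xi> h x\<^sub>1 ps \<omega> n) \<in> L \<rightarrow>\<^sub>M count_space UNIV"
  using p \<xi>
proof (induction n)
  case 0
  then show ?case by simp
next
  case (Suc n)
  have S: "(\<lambda>\<omega>. state_at \<xi> h x\<^sub>1 ps \<omega> n) \<in> L \<rightarrow>\<^sub>M count_space UNIV"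
    using Suc by simp
  have A: "(\<lambda>\<omega>. (ps ! n) (state_at \<xi> h x\<^sub>1 ps \<omega> n) \<omega>) \<in> L \<rightarrow>\<^sub>M count_space UNIV"
    using Suc.prems by (intro feedback_measurable[OF S, where p = "ps ! n"]) auto
  \<comment> \<open>State and action are frozen first, then reinserted one at a time. State index
    \<open>Suc n\<close> uses noise up to \<open>Suc n\<close>, since index 0 is the initial
    state.\<close>
  have "(\<lambda>\<omega>. h x a (\<xi> (Suc n) \<omega>)) \<in> L \<rightarrow>\<^sub>M count_space UNIV" for x a
    by (rule measurable_compose[OF Suc.prems(2) h]) simp
  then have "(\<lambda>\<omega>. h x ((ps ! n) (state_at \<xi> h x\<^sub>1 ps \<omega> n) \<omega>) (\<xi> (Suc n) \<omega>))
      \<in> L \<rightarrow>\<^sub>M count_space UNIV" for x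
    by (rule measurable_compose_countable[OF _ A])
  then have "(\<lambda>\<omega>. h (state_at \<xi> h x\<^sub>1 ps \<omega> n) ((ps ! n) (state_at \<xi> h x\<^sub>1 ps \<omega> n) \<omega>) (\<xi> (Suc n) \<omega>))
      \<in> L \<rightarrow>\<^sub>M count_space UNIV"
    by (rule measurable_compose_countable[OF _ S])
  then show ?case by simp
qed

lemma state_at_cong:
  assumes "\<And>m. m < n \<Longrightarrow> ps ! m = qs ! m"
  shows "state_at \<xi> h x\<^sub>1 ps \<omega> n = state_at \<xi> h x\<^sub>1 qs \<omega> n"
  using assms by (induction n) auto

text \<open>States up to index \<open>i\<close> depend only on the first \<open>i\<close> policies.
  With the trajectory expressed by \<open>ps\<close>, two choices of \<open>q\<close> differ in the
  last action alone and can be compared pointwise.\<close>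

lemma g_avg_take_snoc:
  assumes "i < length ps"
  shows "g_avg M \<xi> h x\<^sub>1 g (take i ps @ [q]) =
    (LINT \<omega>|M. g (map (state_at \<xi> h x\<^sub>1 ps \<omega>) [0..<Suc i])
      (map (action_at \<xi> h x\<^sub>1 ps \<omega>) [0..<i] @ [q (state_at \<xi> h x\<^sub>1 ps \<omega> i) \<omega>]))"
proof -
  let ?qs = "take i ps @ [q]"
  have st: "state_at \<xi> h x\<^sub>1 ?qs \<omega> n = state_at \<xi> h x\<^sub>1 ps \<omega> n" if "n \<le> i" for \<omega> n
    using assms that by (intro state_at_cong) (auto simp: nth_append)
  have ac: "action_at \<xi> h x\<^sub>1 ?qs \<omega> n = action_at \<xi> h x\<^sub>1 ps \<omega> n" if "n < i" for \<omega> n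
    using assms that st[of n] by (simp add: action_at_def nth_append)
  have last: "action_at \<xi> h x\<^sub>1 ?qs \<omega> i = q (state_at \<xi> h x\<^sub>1 ps \<omega> i) \<omega>" for \<omega>
    using assms st[of i] by (simp add: action_at_def nth_append)
  have len: "length ?qs = Suc i" using assms by simp
  have "map (state_at \<xi> h x\<^sub>1 ?qs \<omega>) [0..<Suc i] = map (state_at \<xi> h x\<^sub>1 ps \<omega>) [0..<Suc i]" for \<omega>
    by (rule map_cong) (auto simp: st)
  moreover have "map (action_at \<xi> h x\<^sub>1 ?qs \<omega>) [0..<Suc i]
      = map (action_at \<xi> h x\<^sub>1 ps \<omega>) [0..<i] @ [q (state_at \<xi> h x\<^sub>1 ps \<omega> i) \<omega>]" for \<omega>
    by (simp add: ac last)
  ultimately show ?thesis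
    unfolding g_avg_def len by (simp only: append_is_Nil_conv list.distinct simp_thms if_False)
qed

text \<open>Only finitely many pairs of strings of length \<open>n\<close> exist, so the reward is
  bounded.\<close>

lemma integrable_finite_strings:
  fixes xs :: "'w \<Rightarrow> 'x::finite list" and as :: "'w \<Rightarrow> 'a::finite list"
    and g :: "'x list \<Rightarrow> 'a list \<Rightarrow> real"
  assumes "finite_measure M"
    and xs: "xs \<in> M \<rightarrow>\<^sub>M count_space UNIV" and as: "as \<in> M \<rightarrow>\<^sub>M count_space UNIV"
    and len: "\<And>\<omega>. length (xs \<omega>) = n" "\<And>\<omega>. length (as \<omega>) = n"
  shows "integrable M (\<lambda>\<omega>. g (xs \<omega>) (as \<omega>))"
proof -
  interpret finite_measure M by fact
  let ?S = "{xs :: 'x list. length xs = n} \<times> {as :: 'a list. length as = n}"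
  have "finite ((\<lambda>(xs, as). norm (g xs as)) ` ?S)"
    using finite_lists_length_eq[of "UNIV :: 'x set" n] finite_lists_length_eq[of "UNIV :: 'a set" n]
    by simp
  then obtain B where "\<forall>b\<in>(\<lambda>(xs, as). norm (g xs as)) ` ?S. b \<le> B"
    using bdd_above_finite unfolding bdd_above_def by blast
  then have B: "norm (g (xs \<omega>) (as \<omega>)) \<le> B" for \<omega>
    using len[of \<omega>] by auto
  have "(\<lambda>\<omega>. g ys (as \<omega>)) \<in> borel_measurable M" for ys
    by (rule measurable_compose[OF as]) auto
  then have "(\<lambda>\<omega>. g (xs \<omega>) (as \<omega>)) \<in> borel_measurable M"
    by (rule measurable_compose_countable[OF _ xs])
  then show ?thesis
    using B by (intro integrable_const_bound[of _ B]) auto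
qed

text \<open>Every entry keeps its position, hence its information constraint.\<close>

lemma policy_strings_splice:
  assumes "A \<in> policy_strings M N \<xi>" "B \<in> policy_strings M N \<xi>"
    and "i \<le> j" "j \<le> length B" "length A = length B"
  shows "take i A @ drop i (take j B) \<in> policy_strings M N \<xi>"
  unfolding policy_strings_def mem_Collect_eq
proof
  fix k assume k: "k \<in> {1..length (take i A @ drop i (take j B))}"
  then have "A ! (k - 1) \<in> policy_at M N \<xi> k" "B ! (k - 1) \<in> policy_at M N \<xi> k"
    using assms unfolding policy_strings_def by auto
  then show "(take i A @ drop i (take j B)) ! (k - 1) \<in> policy_at M N \<xi> k"
    using assms k by (auto simp: nth_append)
qed

lemma policy_strings_take_snoc:
  assumes "ps \<in> policy_strings M N \<xi>" "i < length ps" "q \<in> policy_at M N \<xi> (Suc i)"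
  shows "take i ps @ [q] \<in> policy_strings M N \<xi>"
  unfolding policy_strings_def mem_Collect_eq
proof
  fix k assume "k \<in> {1..length (take i ps @ [q])}"
  then show "(take i ps @ [q]) ! (k - 1) \<in> policy_at M N \<xi> k"
    using assms unfolding policy_strings_def by (cases "k = Suc i") (auto simp: nth_append)
qed

lemma policy_strings_nth_measurable:
  assumes "ps \<in> policy_strings M N \<xi>" "m < length ps" "space L = space M"
    and "\<And>i. i \<in> {1..m} \<Longrightarrow> \<xi> i \<in> L \<rightarrow>\<^sub>M N"
  shows "(ps ! m) x \<in> L \<rightarrow>\<^sub>M count_space UNIV"
proof (rule policy_measurable[where k = "Suc m"])
  show "ps ! m \<in> policy_at M N \<xi> (Suc m)"
    using assms(1,2) unfolding policy_strings_def by (auto dest: bspec[of _ _ "Suc m"])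
qed (use assms in auto)

text \<open>States through index \<open>i\<close> and the first \<open>i\<close> actions involve
  noise up to \<open>i\<close> only. So \<open>L\<close> may be the history at time
  \<open>Suc i\<close>, which is what makes a policy built from the past trajectory
  admissible.\<close>

lemma trajectory_measurable:
  fixes h :: "'x::countable \<Rightarrow> 'a::countable \<Rightarrow> 'e \<Rightarrow> 'x"
  assumes h: "\<And>x a. h x a \<in> N \<rightarrow>\<^sub>M count_space UNIV"
    and ps: "ps \<in> policy_strings M N \<xi>" "i < length ps" and L: "space L = space M"
    and \<xi>: "\<And>j. j \<in> {1..i} \<Longrightarrow> \<xi> j \<in> L \<rightarrow>\<^sub>M N"
  shows "(\<lambda>\<omega>. map (state_at \<xi> h x\<^sub>1 ps \<omega>) [0..<Suc i]) \<in> L \<rightarrow>\<^sub>M count_space UNIV"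
    and "(\<lambda>\<omega>. map (action_at \<xi> h x\<^sub>1 ps \<omega>) [0..<i]) \<in> L \<rightarrow>\<^sub>M count_space UNIV"
proof -
  have S: "(\<lambda>\<omega>. state_at \<xi> h x\<^sub>1 ps \<omega> n) \<in> L \<rightarrow>\<^sub>M count_space UNIV" if "n \<le> i" for n
    by (rule state_at_measurable[OF h policy_strings_nth_measurable[OF ps(1) _ L \<xi>] \<xi>])
      (use that ps in auto)
  have A: "(\<lambda>\<omega>. action_at \<xi> h x\<^sub>1 ps \<omega> n) \<in> L \<rightarrow>\<^sub>M count_space UNIV" if "n < i" for n
    unfolding action_at_def
    by (rule feedback_measurable[OF S, where p = "ps ! n"],
        use that in simp, rule policy_strings_nth_measurable[OF ps(1) _ L \<xi>])
      (use that ps in auto)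
  show "(\<lambda>\<omega>. map (state_at \<xi> h x\<^sub>1 ps \<omega>) [0..<Suc i]) \<in> L \<rightarrow>\<^sub>M count_space UNIV"
    using S by (intro measurable_map_upt) auto
  show "(\<lambda>\<omega>. map (action_at \<xi> h x\<^sub>1 ps \<omega>) [0..<i]) \<in> L \<rightarrow>\<^sub>M count_space UNIV"
    using A by (intro measurable_map_upt) auto
qed


section \<open>The last policy of a string\<close>

text \<open>The last policy is only required to be measurable in \<open>M\<close>, so anticipating
  policies are covered.\<close>

lemma integrable_last_policy:
  fixes h :: "'x::finite \<Rightarrow> 'a::finite \<Rightarrow> 'e \<Rightarrow> 'x"
    and g :: "'x list \<Rightarrow> 'a list \<Rightarrow> real"
  assumes M: "finite_measure M"
    and h: "\<And>x a. h x a \<in> N \<rightarrow>\<^sub>M count_space UNIV"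
    and \<xi>: "\<And>j. j \<in> {1..i} \<Longrightarrow> \<xi> j \<in> M \<rightarrow>\<^sub>M N"
    and ps: "ps \<in> policy_strings M N \<xi>" "i < length ps"
    and q: "\<And>x. q x \<in> M \<rightarrow>\<^sub>M count_space UNIV"
  shows "integrable M (\<lambda>\<omega>. g (map (state_at \<xi> h x\<^sub>1 ps \<omega>) [0..<Suc i])
      (map (action_at \<xi> h x\<^sub>1 ps \<omega>) [0..<i] @ [q (state_at \<xi> h x\<^sub>1 ps \<omega> i) \<omega>]))"
proof (rule integrable_finite_strings[OF M, where n = "Suc i" and g = g
      and xs = "\<lambda>\<omega>. map (state_at \<xi> h x\<^sub>1 ps \<omega>) [0..<Suc i]"])
  note traj = trajectory_measurable[OF h ps refl \<xi>]
  show "(\<lambda>\<omega>. map (state_at \<xi> h x\<^sub>1 ps \<omega>) [0..<Suc i]) \<in> M \<rightarrow>\<^sub>M count_space UNIV"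
    by (rule traj)
  have "(\<lambda>\<omega>. state_at \<xi> h x\<^sub>1 ps \<omega> i) \<in> M \<rightarrow>\<^sub>M count_space UNIV"
    by (rule state_at_measurable[OF h policy_strings_nth_measurable[OF ps(1) _ refl \<xi>] \<xi>])
      (use ps in auto)
  from feedback_measurable[OF this q]
  have q': "(\<lambda>\<omega>. q (state_at \<xi> h x\<^sub>1 ps \<omega> i) \<omega>) \<in> M \<rightarrow>\<^sub>M count_space UNIV" .
  have "(\<lambda>\<omega>. as @ [q (state_at \<xi> h x\<^sub>1 ps \<omega> i) \<omega>]) \<in> M \<rightarrow>\<^sub>M count_space UNIV" for as
    by (rule measurable_compose[OF q']) auto
  then show "(\<lambda>\<omega>. map (action_at \<xi> h x\<^sub>1 ps \<omega>) [0..<i] @ [q (state_at \<xi> h x\<^sub>1 ps \<omega> i) \<omega>])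
      \<in> M \<rightarrow>\<^sub>M count_space UNIV"
    by (rule measurable_compose_countable[OF _ traj(2)])
qed simp_all

lemma g_avg_take_le_snoc:
  fixes h :: "'x::finite \<Rightarrow> 'a::finite \<Rightarrow> 'e \<Rightarrow> 'x"
  assumes M: "finite_measure M"
    and h: "\<And>x a. h x a \<in> N \<rightarrow>\<^sub>M count_space UNIV"
    and g_nonneg: "\<And>xs as. xs \<noteq> [] \<Longrightarrow> as \<noteq> [] \<Longrightarrow> g xs as \<ge> 0"
    and monotone: "prefix_monotone (policy_strings M N \<xi>) K (g_avg M \<xi> h x\<^sub>1 g)"
    and \<xi>: "\<And>j. j \<in> {1..i} \<Longrightarrow> \<xi> j \<in> M \<rightarrow>\<^sub>M N"
    and ps: "ps \<in> policy_strings M N \<xi>" "length ps = K" "i < K"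
    and q: "\<And>x. q x \<in> M \<rightarrow>\<^sub>M count_space UNIV"
  shows "g_avg M \<xi> h x\<^sub>1 g (take i ps) \<le> g_avg M \<xi> h x\<^sub>1 g (take i ps @ [q])"
proof -
  define \<phi> where "\<phi> xs as = (SOME a. is_arg_min (\<lambda>a. g xs (as @ [a])) (\<lambda>a. a \<in> UNIV) a)" for xs as
  \<comment> \<open>The worst adapted policy: it ignores its state argument and recomputes the whole
    trajectory from the sample point, because the minimizing action depends on the full
    past.\<close>
  define r where "r x \<omega> = \<phi> (map (state_at \<xi> h x\<^sub>1 ps \<omega>) [0..<Suc i])
    (map (action_at \<xi> h x\<^sub>1 ps \<omega>) [0..<i])" for x :: 'x and \<omega>
  have i: "i < length ps" using ps by simp
  have \<phi>: "g xs (as @ [\<phi> xs as]) \<le> g xs (as @ [a])" for xs as a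
  proof -
    have "\<exists>a. is_arg_min (\<lambda>a. g xs (as @ [a])) (\<lambda>a. a \<in> UNIV) a"
      by (rule ex_is_arg_min_if_finite) auto
    from someI_ex[OF this] show ?thesis
      unfolding \<phi>_def[symmetric] by (auto simp: is_arg_min_def not_less)
  qed
  have "r \<in> policy_at M N \<xi> (Suc i)"
  proof -
    have \<xi>': "\<xi> j \<in> history M N \<xi> (Suc i) \<rightarrow>\<^sub>M N" if "j \<in> {1..i}" for j
      using that by (intro measurable_noise_history) (auto intro: \<xi>)
    note traj = trajectory_measurable[OF h ps(1) i space_history \<xi>']
    have "(\<lambda>\<omega>. \<phi> xs (map (action_at \<xi> h x\<^sub>1 ps \<omega>) [0..<i]))
        \<in> history M N \<xi> (Suc i) \<rightarrow>\<^sub>M count_space UNIV" for xs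
      by (rule measurable_compose[OF traj(2)]) auto
    then have "r x \<in> history M N \<xi> (Suc i) \<rightarrow>\<^sub>M count_space UNIV" for x
      unfolding r_def by (rule measurable_compose_countable[OF _ traj(1)])
    then show ?thesis
      unfolding policy_at_def by blast
  qed
  then have "take i ps @ [r] \<in> policy_strings M N \<xi>"
    using ps i by (intro policy_strings_take_snoc)
  moreover have "take i ps \<in> policy_strings M N \<xi>"
    using policy_strings_splice[OF ps(1) ps(1), of i i] i by simp
  ultimately have "g_avg M \<xi> h x\<^sub>1 g (take i ps) \<le> g_avg M \<xi> h x\<^sub>1 g (take i ps @ [r])"
    using monotone ps unfolding prefix_monotone_def by auto
  \<comment> \<open>Monotonicity of \<open>g_avg\<close> covers the adapted \<open>r\<close>; the
    passage to \<open>q\<close> is a pathwise comparison with the minimum.\<close>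
  also have "\<dots> \<le> g_avg M \<xi> h x\<^sub>1 g (take i ps @ [q])"
    unfolding g_avg_take_snoc[OF i]
    by (rule integral_mono'[OF integrable_last_policy[OF M h \<xi> ps(1) i q]])
      (auto simp: r_def simp del: upt_Suc intro: \<phi> g_nonneg)
  finally show ?thesis .
qed

lemma pdao_scheme_greedy:
  fixes h :: "'x::finite \<Rightarrow> 'a::finite \<Rightarrow> 'e \<Rightarrow> 'x"
  assumes M: "finite_measure M"
    and h: "\<And>x a. h x a \<in> N \<rightarrow>\<^sub>M count_space UNIV"
    and g_nonneg: "\<And>xs as. xs \<noteq> [] \<Longrightarrow> as \<noteq> [] \<Longrightarrow> g xs as \<ge> 0"
    and \<xi>: "\<And>j. j \<in> {1..i} \<Longrightarrow> \<xi> j \<in> M \<rightarrow>\<^sub>M N"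
    and pdao: "pdao_scheme M N \<xi> h x\<^sub>1 g K G" and "i < K"
  shows "g_avg M \<xi> h x\<^sub>1 g (take i G @ [q]) \<le> g_avg M \<xi> h x\<^sub>1 g (take (Suc i) G)"
proof -
  have G: "G \<in> policy_strings M N \<xi>" "i < length G"
    using pdao \<open>i < K\<close> unfolding pdao_scheme_def by auto
  have "(G ! i) x \<in> M \<rightarrow>\<^sub>M count_space UNIV" for x
    by (rule policy_strings_nth_measurable[OF G refl \<xi>])
  moreover have "g (map (state_at \<xi> h x\<^sub>1 G \<omega>) [0..<Suc i]) (map (action_at \<xi> h x\<^sub>1 G \<omega>) [0..<i] @ [b])
      \<le> g (map (state_at \<xi> h x\<^sub>1 G \<omega>) [0..<Suc i])
          (map (action_at \<xi> h x\<^sub>1 G \<omega>) [0..<i] @ [(G ! i) (state_at \<xi> h x\<^sub>1 G \<omega> i) \<omega>])"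
    if "\<omega> \<in> space M" for \<omega> b
  proof -
    have "is_arg_max (\<lambda>a. g (map (state_at \<xi> h x\<^sub>1 G \<omega>) [0..<Suc i])
        (map (action_at \<xi> h x\<^sub>1 G \<omega>) [0..<i] @ [a])) (\<lambda>a. a \<in> UNIV) (action_at \<xi> h x\<^sub>1 G \<omega> i)"
      using pdao that \<open>i < K\<close> unfolding pdao_scheme_def by blast
    then show ?thesis
      unfolding is_arg_max_def action_at_def[of _ _ _ _ _ i] by (meson UNIV_I not_less)
  qed
  \<comment> \<open>Here \<open>q\<close> is arbitrary: if its integrand is not integrable, the
    integral is 0 by default and the nonnegative reward of the scheme still dominates.\<close>
  ultimately have "g_avg M \<xi> h x\<^sub>1 g (take i G @ [q]) \<le> g_avg M \<xi> h x\<^sub>1 g (take i G @ [G ! i])"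
    unfolding g_avg_take_snoc[OF G(2)]
    by (intro integral_mono'[OF integrable_last_policy[OF M h \<xi> G]] g_nonneg) auto
  then show ?thesis
    using G by (simp add: take_Suc_conv_app_nth)
qed

section \<open>The control problem as an instance of \<open>greedy_string\<close>\<close>

theorem theorem3:
  fixes M :: "'w measure" and N :: "'e measure" and \<xi> :: "nat \<Rightarrow> 'w \<Rightarrow> 'e"
    and h :: "'x::finite \<Rightarrow> 'a::finite \<Rightarrow> 'e \<Rightarrow> 'x" and x\<^sub>1 :: 'x
    and g :: "'x list \<Rightarrow> 'a list \<Rightarrow> real" and K :: nat
    and f :: "('x, 'w, 'a) policy list \<Rightarrow> real"
    and P :: "('x, 'w, 'a) policy list set"
    and G Opt :: "('x, 'w, 'a) policy list"
    and \<eta> \<sigma> :: real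
  assumes K_pos: "K \<ge> 1"
    and prob: "prob_space M"
    and indep: "prob_space.indep_vars M (\<lambda>_. N) \<xi> {1..K-1}"
    and ident: "\<And>i j. i \<in> {1..K-1} \<Longrightarrow> j \<in> {1..K-1} \<Longrightarrow> distr M N (\<xi> i) = distr M N (\<xi> j)"
    and h_meas: "\<And>x a. h x a \<in> N \<rightarrow>\<^sub>M count_space UNIV"
    and g_nonneg: "\<And>xs as. xs \<noteq> [] \<Longrightarrow> as \<noteq> [] \<Longrightarrow> g xs as \<ge> 0"
    and P_eq: "P = policy_strings M N \<xi>"
    and f_eq: "f = g_avg M \<xi> h x\<^sub>1 g"
    and optimal: "optimal_policy M N \<xi> h x\<^sub>1 g K Opt"
    and optimal_pos: "f Opt > 0"
    and monotone: "prefix_monotone P K f"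
    and pdao: "pdao_scheme M N \<xi> h x\<^sub>1 g K G"
    and eta_exists: "has_maximum (total_curvature_values P K f G)"
    and sigma_exists: "has_maximum (forward_curvature_values P K f G)"
    and eta_eq: "\<eta> = total_curvature P K f G"
    and sigma_eq: "\<sigma> = forward_curvature P K f G"
    and eta_nonzero: "\<eta> \<noteq> 0"
  shows "f G / f Opt \<ge> 1 / \<eta> * (1 - (1 - \<eta> * ((1 - \<sigma>) / real K)) ^ K)
       \<and> (\<eta> > 0 \<and> \<sigma> < 1 \<longrightarrow>
            1 / \<eta> * (1 - (1 - \<eta> * ((1 - \<sigma>) / real K)) ^ K)
              > (1 - exp (- \<eta> * (1 - \<sigma>))) / \<eta>)"
proof -
  interpret prob_space M by (rule prob)
  have \<xi>: "\<xi> j \<in> M \<rightarrow>\<^sub>M N" if "j \<in> {1..K - 1}" for j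
    using indep that unfolding indep_vars_def by auto
  have G: "G \<in> P" "length G = K"
    using pdao unfolding P_eq pdao_scheme_def by auto
  have Opt: "Opt \<in> P" "length Opt = K" "\<And>Q. Q \<in> P \<Longrightarrow> length Q = K \<Longrightarrow> f Q \<le> f Opt"
    using optimal unfolding P_eq f_eq optimal_policy_def is_arg_max_def by (auto simp: not_less)
  interpret greedy_string P K f G Opt
  proof
    show "take i A @ drop i (take j B) \<in> P"
      if "A \<in> P" "B \<in> P" "length A = K" "length B = K" "i \<le> j" "j \<le> K" for A B i j
      using that unfolding P_eq by (intro policy_strings_splice) auto
    show "f (take i G @ [Q ! j]) \<le> f (take (Suc i) G)"
      if "Q \<in> P" "length Q = K" "i < K" "j < K" for Q i j
      unfolding f_eq using that
      by (intro pdao_scheme_greedy[OF _ h_meas g_nonneg _ pdao] \<xi>) (auto intro: finite_measure_axioms)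
    show "f (take i G) \<le> f (take i G @ [Q ! j])"
      if Q: "Q \<in> P" "length Q = K" "i < K" "j < K" for Q i j
      unfolding f_eq
    proof (intro g_avg_take_le_snoc[OF _ h_meas g_nonneg, where K = K])
      \<comment> \<open>\<open>Q ! j\<close> is adapted to time \<open>Suc j\<close> but is placed
        at time \<open>Suc i\<close>; measurability in \<open>M\<close> survives this move.\<close>
      show "(Q ! j) x \<in> M \<rightarrow>\<^sub>M count_space UNIV" for x
        using Q by (intro policy_strings_nth_measurable[OF Q(1)[unfolded P_eq] _ refl \<xi>]) auto
    qed (use Q G monotone in \<open>auto simp: P_eq f_eq intro: \<xi> finite_measure_axioms\<close>)
  qed (use K_pos G Opt optimal_pos monotone eta_exists sigma_exists in \<open>auto simp: f_eq g_avg_def\<close>)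
  show ?thesis
    using greedy_bound greedy_bound_greater eta_nonzero unfolding eta_eq sigma_eq by blast
qed

end
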